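(* For any $n\ge1$, $$\sum_{\pi\in\mathfrak{S}_n(213)}(-1)^{\mathsf{exc}\,\pi}=\sum_{\pi\in\mathfrak{S}_n(132)}(-1)^{\mathsf{exc}\,\pi}=\begin{cases}0,&n\text{ even},\\(-1)^{(n-1)/2}C_{(n-1)/2},&n\text{ odd},\end{cases}$$ $$\sum_{\pi\in\mathfrak{D}_n(213)}(-1)^{\mathsf{exc}\,\pi}=\sum_{\pi\in\mathfrak{D}_n(132)}(-1)^{\mathsf{exc}\,\pi}=\begin{cases}(-1)^{n/2}C_{n/2},&n\text{ even},\\0,&n\text{ odd}.\end{cases}$$
   Context: $C_m=\frac{1}{m+1}\binom{2m}{m}$ is the Catalan number. $\mathfrak{S}_n(\tau)$: permutations of $[n]$ avoiding classical pattern $\tau$; $\mathfrak{D}_n(\tau)$: those with no fixed point (derangements). $\mathsf{exc}\,\pi=\#\{i:\pi(i)>i\}$. *)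

theory Defs
  imports "HOL-Combinatorics.Permutations"
begin

definition catalan :: "nat \<Rightarrow> nat" where
  "catalan m = (2*m choose m) div (m+1)"

(* classical pattern containment: pattern tau is a permutation of {1..k} *)
definition contains_pattern :: "(nat \<Rightarrow> nat) \<Rightarrow> nat \<Rightarrow> (nat \<Rightarrow> nat) \<Rightarrow> nat \<Rightarrow> bool" where
  "contains_pattern p n tau k \<longleftrightarrow>
     (\<exists>idx::nat \<Rightarrow> nat. strict_mono_on {1..k} idx \<and> idx ` {1..k} \<subseteq> {1..n} \<and>
        (\<forall>a\<in>{1..k}. \<forall>b\<in>{1..k}. p (idx a) < p (idx b) \<longleftrightarrow> tau a < tau b))"

definition avoiders :: "nat \<Rightarrow> (nat \<Rightarrow> nat) \<Rightarrow> nat \<Rightarrow> (nat \<Rightarrow> nat) set" where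
  "avoiders n tau k = {p. p permutes {1..n} \<and> \<not> contains_pattern p n tau k}"

definition derangement_avoiders :: "nat \<Rightarrow> (nat \<Rightarrow> nat) \<Rightarrow> nat \<Rightarrow> (nat \<Rightarrow> nat) set" where
  "derangement_avoiders n tau k = {p \<in> avoiders n tau k. \<forall>i\<in>{1..n}. p i \<noteq> i}"

definition exc :: "nat \<Rightarrow> (nat \<Rightarrow> nat) \<Rightarrow> nat" where
  "exc n p = card {i\<in>{1..n}. p i > i}"

definition pat213 :: "nat \<Rightarrow> nat" where
  "pat213 i = (if i = 1 then 2 else if i = 2 then 1 else if i = 3 then 3 else i)"

definition pat132 :: "nat \<Rightarrow> nat" where
  "pat132 i = (if i = 1 then 1 else if i = 2 then 3 else if i = 3 then 2 else i)"

end

theory Submission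
  imports Defs "HOL-Library.FuncSet"
begin

text \<open>
  Give an excedance weight \<open>-1\<close>, a fixed point weight \<open>x\<close> and every other position weight \<open>1\<close>; then
  \<open>x = 1\<close> yields the sum over all permutations and \<open>x = 0\<close> the sum over derangements.
  A 132-avoider splits at its maximum as \<open>L n R\<close> with \<open>L\<close> above \<open>R\<close>. This recursion is that of Dyck
  paths on \<open>[-n, n]\<close> in which each tunnel is weighted by the sign of the sum of its endpoints
  (Elizalde). Following the bijection of Elizalde and Deutsch, read the steps from the two
  ends inwards, alternating left and right: the first endpoint of a tunnel to be read already decides
  its sign, so only the number \<open>2k\<close> of open tunnels has to be remembered. For the resulting numbers
  \<open>r m k\<close> the two contributions that keep \<open>k > 0\<close> fixed cancel, whence
  \<open>r (m+1) (k+1) = r m k - r m (k+2)\<close> and \<open>r (m+1) 0 = x * r m 0 - r m 1\<close>. For \<open>x = 0\<close> these are signed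
  ballot numbers, and the case \<open>x = 1\<close> reduces to \<open>x = 0\<close>. Finally, 213 is obtained from 132 by
  inverting and taking the reverse-complement, which preserves excedances and fixed points.
\<close>

subsection \<open>Signed Dyck paths\<close>

text \<open>The argument is the sum of the endpoints of a tunnel, or position minus value for an
  entry of a permutation; negative then means excedance.\<close>

definition sign_weight :: "int \<Rightarrow> int \<Rightarrow> int" where
  "sign_weight x e = (if e < 0 then -1 else if e = 0 then x else 1)"

text \<open>\<open>arch x s t\<close> is the sum over all Dyck paths from abscissa \<open>s\<close> to abscissa \<open>t\<close> of the product of
  \<open>sign_weight x (a + b)\<close> over all tunnels (matched pairs of steps) reaching from \<open>a\<close> to \<open>b\<close>; the
  recursion removes the first arch. It vanishes for \<open>t < s\<close> and for odd \<open>t - s\<close>.\<close>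

function arch :: "int \<Rightarrow> int \<Rightarrow> int \<Rightarrow> int" where
  "arch x s t = (if t < s then 0 else if s = t then 1 else
     (\<Sum>c\<in>{s+1..<t}. sign_weight x (s + c + 1) * (arch x (s+1) c * arch x (c+1) t)))"
  by pat_completeness auto
termination by (relation "measure (\<lambda>(x, s, t). nat (t - s))") auto

declare arch.simps [simp del]

lemma arch_refl [simp]: "arch x s s = 1"
  by (subst arch.simps) simp

lemma arch_left:
  assumes "s < t"
  shows "arch x s t =
    (\<Sum>c\<in>{s+1..<t}. sign_weight x (s + c + 1) * (arch x (s+1) c * arch x (c+1) t))"
  using assms by (subst arch.simps) simp

text \<open>Removing an arch leaves two intervals whose lengths add up to \<open>t - s - 2\<close>,
  so one of them is again odd.\<close>

lemma arch_odd: "odd (t - s) \<Longrightarrow> arch x s t = 0"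
proof (induction "nat (t - s)" arbitrary: s t rule: less_induct)
  case less
  show ?case
  proof (cases "s < t")
    case False
    with less.prems show ?thesis by (subst arch.simps) auto
  next
    case True
    have "arch x (s+1) c * arch x (c+1) t = 0" if "c \<in> {s+1..<t}" for c
    proof (cases "odd (c - (s+1))")
      case True
      then show ?thesis using less.hyps[of c "s+1"] that by auto
    next
      case False
      then have "odd (t - (c+1))" using less.prems by auto
      then show ?thesis using less.hyps[of t "c+1"] that by auto
    qed
    then show ?thesis unfolding arch_left[OF True] by (intro sum.neutral) auto
  qed
qed

section \<open>Path sums with unmatched steps\<close>

text \<open>The gap from \<open>d\<close> to \<open>d+1\<close> holds one unmatched step between the
  two factors.\<close>

definition step_conv ::
  "(int \<Rightarrow> int \<Rightarrow> int) \<Rightarrow> (int \<Rightarrow> int \<Rightarrow> int) \<Rightarrow> int \<Rightarrow> int \<Rightarrow> int" where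
  "step_conv f g s t = (\<Sum>d\<in>{s..<t}. f s d * g (d+1) t)"

lemma sum_triangle_swap:
  fixes F :: "int \<Rightarrow> int \<Rightarrow> int"
  shows "(\<Sum>e\<in>{s..<t}. \<Sum>d\<in>{s..<e}. F d e) = (\<Sum>d\<in>{s..<t}. \<Sum>e\<in>{d+1..<t}. F d e)"
proof -
  have "(\<Sum>e\<in>{s..<t}. \<Sum>d\<in>{d\<in>{s..<t}. d < e}. F d e)
      = (\<Sum>d\<in>{s..<t}. \<Sum>e\<in>{e\<in>{s..<t}. d < e}. F d e)"
    by (rule sum.swap_restrict) auto
  moreover have "{d\<in>{s..<t}. d < e} = {s..<e}" if "e \<in> {s..<t}" for e
    using that by auto
  moreover have "{e\<in>{s..<t}. d < e} = {d+1..<t}" if "d \<in> {s..<t}" for d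
    using that by auto
  ultimately show ?thesis by simp
qed

lemma step_conv_assoc: "step_conv (step_conv f g) h = step_conv f (step_conv g h)"
proof (intro ext)
  fix s t
  have "step_conv (step_conv f g) h s t
      = (\<Sum>e\<in>{s..<t}. \<Sum>d\<in>{s..<e}. f s d * g (d+1) e * h (e+1) t)"
    by (simp add: step_conv_def sum_distrib_right)
  also have "\<dots> = step_conv f (step_conv g h) s t"
    by (simp add: sum_triangle_swap step_conv_def sum_distrib_left mult.assoc)
  finally show "step_conv (step_conv f g) h s t = step_conv f (step_conv g h) s t" .
qed

text \<open>Mirror image of the defining recursion. Remove the first arch, then by induction the
  last arch of what follows it; swap the sums and reassemble the first arch. A path that is a single
  arch appears as \<open>c = t-1\<close> on one side and as \<open>d = s\<close> on the
  other.\<close>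

lemma arch_right:
  "s < t \<Longrightarrow> arch x s t =
    (\<Sum>d\<in>{s..<t-1}. sign_weight x (d + t) * (arch x s d * arch x (d+1) (t-1)))"
proof (induction "nat (t - s)" arbitrary: s t rule: less_induct)
  case less
  let ?w = "sign_weight x"
  show ?case
  proof (cases "t = s + 1")
    case True
    then show ?thesis by (simp add: arch_odd)
  next
    case False
    with less.prems have st: "s + 1 < t" by simp
    have L: "{s+1..<t} = insert (t-1) {s+1..<t-1}" and R: "{s..<t-1} = insert s {s+1..<t-1}"
      using st by auto
    have "arch x s t = ?w (s+t) * arch x (s+1) (t-1)
       + (\<Sum>c\<in>{s+1..<t-1}. ?w (s+c+1) * (arch x (s+1) c * arch x (c+1) t))"
      unfolding arch_left[OF less.prems] L by simp
    also have "(\<Sum>c\<in>{s+1..<t-1}. ?w (s+c+1) * (arch x (s+1) c * arch x (c+1) t))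
       = (\<Sum>c\<in>{s+1..<t-1}. \<Sum>d\<in>{c+1..<t-1}. ?w (s+c+1) * arch x (s+1) c *
            (?w (d+t) * (arch x (c+1) d * arch x (d+1) (t-1))))"
      by (intro sum.cong refl) (subst less.hyps, auto simp: sum_distrib_left mult_ac)
    also have "\<dots> = (\<Sum>d\<in>{s+1..<t-1}. \<Sum>c\<in>{s+1..<d}. ?w (s+c+1) * arch x (s+1) c *
            (?w (d+t) * (arch x (c+1) d * arch x (d+1) (t-1))))"
      by (rule sum_triangle_swap[symmetric])
    also have "\<dots> = (\<Sum>d\<in>{s+1..<t-1}. ?w (d+t) * (arch x s d * arch x (d+1) (t-1)))"
      by (intro sum.cong refl)
         (subst arch_left[of s], auto simp: sum_distrib_left sum_distrib_right mult_ac)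
    finally show ?thesis unfolding R by simp
  qed
qed

text \<open>In terms of paths, \<open>chain x c\<close> sums over Dyck paths with \<open>c\<close> additional unmatched steps, which
  carry no weight.\<close>

primrec chain :: "int \<Rightarrow> nat \<Rightarrow> int \<Rightarrow> int \<Rightarrow> int" where
  "chain x 0 = arch x"
| "chain x (Suc c) = step_conv (arch x) (chain x c)"

lemma step_conv_chain: "step_conv (chain x a) (chain x b) = chain x (Suc (a + b))"
  by (induction a) (simp_all add: step_conv_assoc)

text \<open>The first arch ends at \<open>t\<close> at the latest, so its weight is always -1. Once
  that is factored out, its closing step is just an unmatched step.\<close>

lemma arch_left_neg:
  assumes "s < t" "s + t < 0"
  shows "arch x s t = - chain x 1 (s+1) t"
  using assms by (simp add: arch_left step_conv_def sign_weight_def sum_negf[symmetric])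

lemma arch_right_pos:
  assumes "s < t" "s + t > 0"
  shows "arch x s t = chain x 1 s (t-1)"
  using assms by (simp add: arch_right step_conv_def sign_weight_def)

text \<open>The step at \<open>s\<close> is either the first unmatched one (\<open>d = s\<close>) or
  opens an arch, whose closing step then joins the \<open>Suc c\<close> unmatched ones. That arch
  ends at \<open>d < t\<close> or before, so its weight is -1 even if
  \<open>s + t = 0\<close>.\<close>

lemma chain_step_left:
  assumes "s < t" "s + t \<le> 0"
  shows "chain x (Suc c) s t = chain x c (s+1) t - chain x (Suc (Suc c)) (s+1) t"
proof -
  have L: "{s..<t} = insert s {s+1..<t}" using assms by auto
  have "chain x (Suc c) s t
      = chain x c (s+1) t + (\<Sum>d\<in>{s+1..<t}. arch x s d * chain x c (d+1) t)"
    by (simp add: step_conv_def L)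
  also have "(\<Sum>d\<in>{s+1..<t}. arch x s d * chain x c (d+1) t)
      = (\<Sum>d\<in>{s+1..<t}. - (chain x 1 (s+1) d * chain x c (d+1) t))"
    using assms by (intro sum.cong refl) (subst arch_left_neg, auto)
  also have "\<dots> = - step_conv (chain x 1) (chain x c) (s+1) t"
    by (simp add: step_conv_def sum_negf)
  finally show ?thesis by (simp only: step_conv_chain) simp
qed

lemma chain_step_right:
  assumes "s < t" "s + t > 0"
  shows "chain x (Suc c) s t = chain x c s (t-1) + chain x (Suc (Suc c)) s (t-1)"
proof -
  have R: "{s..<t} = insert (t-1) {s..<t-1}" using assms by auto
  have "chain x (Suc c) s t = step_conv (chain x c) (chain x 0) s t"
    by (simp only: step_conv_chain) simp
  also have "\<dots> = chain x c s (t-1) + (\<Sum>d\<in>{s..<t-1}. chain x c s d * arch x (d+1) t)"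
    by (simp add: step_conv_def R)
  also have "(\<Sum>d\<in>{s..<t-1}. chain x c s d * arch x (d+1) t)
      = step_conv (chain x c) (chain x 1) s (t-1)"
    unfolding step_conv_def using assms
    by (intro sum.cong refl) (subst arch_right_pos, auto)
  finally show ?thesis by (simp only: step_conv_chain) simp
qed

section \<open>Recursion on centred intervals\<close>

text \<open>This is \<open>r m k\<close>: the unread middle of a path, whose unmatched steps belong
  to tunnels with their other endpoint already read. Their number is even because the length
  is.\<close>

definition centred :: "int \<Rightarrow> nat \<Rightarrow> nat \<Rightarrow> int" where
  "centred x m k = chain x (2 * k) (- int m) (int m)"

lemma centred_0: "centred x 0 k = (if k = 0 then 1 else 0)"
  by (cases k) (simp_all add: centred_def step_conv_def)

text \<open>Reading on the left gives \<open>2k+1\<close> unmatched steps minus \<open>2k+3\<close>;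
  reading on the right then gives \<open>2k\<close> and \<open>2k+2\<close> minus
  \<open>2k+2\<close> and \<open>2k+4\<close>.\<close>

lemma centred_Suc_Suc: "centred x (Suc m) (Suc k) = centred x m k - centred x m (k + 2)"
  using chain_step_left[of "- int (Suc m)" "int (Suc m)" x "2*k+1"]
    chain_step_right[of "- int m" "int (Suc m)" x "2*k"]
    chain_step_right[of "- int m" "int (Suc m)" x "2*k+2"]
  by (simp add: centred_def del: chain.simps)

text \<open>The first arch either spans the whole interval (\<open>c = m\<close>), with weight
  \<open>x\<close>, or is shorter, with weight -1. The shorter ones sum to \<open>chain x 1\<close>
  on \<open>[-m, m+1]\<close> without its term \<open>c = m\<close>, and
  \<open>chain_step_right\<close> turns this into \<open>chain x 2\<close> on
  \<open>[-m, m]\<close>.\<close>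

lemma centred_Suc_0: "centred x (Suc m) 0 = x * centred x m 0 - centred x m 1"
proof -
  let ?s = "- int m" and ?t = "int (Suc m)"
  have L: "{?s..<?t} = insert (int m) {?s..<int m}" by auto
  have "arch x (- int (Suc m)) ?t
      = x * arch x ?s (int m) - (\<Sum>c\<in>{?s..<int m}. arch x ?s c * arch x (c+1) ?t)"
  proof -
    have "arch x (- int (Suc m)) ?t = (\<Sum>c\<in>{?s..<?t}. sign_weight x (?s + c) *
        (arch x ?s c * arch x (c+1) ?t))"
      by (subst arch_left) simp_all
    also have "\<dots> = x * arch x ?s (int m)
        + (\<Sum>c\<in>{?s..<int m}. - (arch x ?s c * arch x (c+1) ?t))"
      unfolding L by (simp add: sign_weight_def add.commute)
    finally show ?thesis by (simp add: sum_negf)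
  qed
  moreover have "chain x 1 ?s ?t
      = arch x ?s (int m) + (\<Sum>c\<in>{?s..<int m}. arch x ?s c * arch x (c+1) ?t)"
    unfolding One_nat_def chain.simps step_conv_def L by (simp add: add.commute)
  ultimately show ?thesis
    using chain_step_right[of ?s ?t x 0]
    by (simp add: centred_def numeral_2_eq_2 algebra_simps)
qed

section \<open>Ballot numbers and the solution of the recursion\<close>

text \<open>For \<open>2 * j <= m\<close>, the number of nonnegative paths with \<open>m\<close>
  steps, \<open>j\<close> of them down. The separate case \<open>j = 0\<close> is there because
  \<open>0 - 1 = 0\<close> for naturals.\<close>

definition ballot :: "nat \<Rightarrow> nat \<Rightarrow> int" where
  "ballot m j = int (m choose j) - (if j = 0 then 0 else int (m choose (j - 1)))"

lemma ballot_Suc: "ballot (Suc m) (Suc j) = ballot m (Suc j) + ballot m j"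
  by (cases j) (simp_all add: ballot_def)

lemma ballot_middle: "ballot (Suc (2 * i)) (Suc i) = 0"
  using binomial_symmetric[of "Suc i" "Suc (2*i)"] by (simp add: ballot_def)

text \<open>Since \<open>m+1\<close> times the binomial of \<open>2m\<close> over \<open>m-1\<close>
  is \<open>m\<close> times the central one, the central one equals \<open>m+1\<close> times the
  ballot number; the division in \<open>catalan\<close> is exact.\<close>

lemma catalan_eq_ballot: "int (catalan m) = ballot (2 * m) m"
proof (cases m)
  case 0
  then show ?thesis by (simp add: catalan_def ballot_def)
next
  case (Suc i)
  have "(m + 1) * (2 * m choose (m + 1)) = m * (2 * m choose m)"
    using binomial_absorb_comp[of "2*m" m] binomial_absorption[of m "2*m"] by (auto simp: mult_2)
  moreover have "2 * m choose (m + 1) = 2 * m choose i"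
    using binomial_symmetric[of "m+1" "2*m"] Suc by simp
  ultimately have "(m + 1) * (2 * m choose i) = m * (2 * m choose m)" by simp
  then have eq: "int (m + 1) * int (2 * m choose i) = int m * int (2 * m choose m)"
    by (metis of_nat_mult)
  have "int (2 * m choose m) = int (m + 1) * ballot (2 * m) m"
    using eq Suc by (simp add: ballot_def algebra_simps)
  then have "int (catalan m) = (int (m + 1) * ballot (2 * m) m) div int (m + 1)"
    by (simp add: catalan_def zdiv_int)
  then show ?thesis by simp
qed

text \<open>With the signs \<open>(-1) ^ j\<close> the recursion for positive \<open>k\<close>
  becomes the Pascal rule \<open>ballot_Suc\<close>. At \<open>k = 0\<close> one summand of that
  rule is missing from the recursion, and \<open>ballot_middle\<close> says that it is zero.\<close>

lemma centred_zero:
  "(\<forall>k j. m = k + 2 * j \<longrightarrow> centred 0 m k = (-1) ^ j * ballot m j) \<and>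
   (\<forall>k. (\<nexists>j. m = k + 2 * j) \<longrightarrow> centred 0 m k = 0)"
proof (induction m)
  case 0
  then show ?case by (auto simp: centred_0 ballot_def)
next
  case (Suc m)
  have IH1: "centred 0 m k = (-1) ^ j * ballot m j" if "m = k + 2 * j" for k j
    using Suc that by blast
  have IH2: "centred 0 m k = 0" if "\<nexists>j. m = k + 2 * j" for k
    using Suc that by blast
  have "centred 0 (Suc m) k = (-1) ^ j * ballot (Suc m) j" if m: "Suc m = k + 2 * j" for k j
  proof (cases k)
    case 0
    with m obtain i where j: "j = Suc i" and m': "m = Suc (2 * i)" by (cases j) auto
    have "centred 0 (Suc m) 0 = - ((-1) ^ i * ballot m i)"
      using IH1[of 1 i] m' by (simp add: centred_Suc_0)
    then show ?thesis using 0 j m' ballot_middle[of i] by (simp add: ballot_Suc)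
  next
    case (Suc k')
    show ?thesis
    proof (cases j)
      case 0
      \<comment> \<open>Here \<open>k' = m\<close>, so \<open>k' + 2\<close> lies beyond the
        support.\<close>
      then have "centred 0 m (k' + 2) = 0" using m Suc by (intro IH2) auto
      then show ?thesis
        using IH1[of k' 0] 0 m Suc by (simp add: centred_Suc_Suc ballot_def)
    next
      case j: (Suc i)
      show ?thesis
        using IH1[of k' j] IH1[of "k' + 2" i] m Suc j
        by (simp add: centred_Suc_Suc ballot_Suc algebra_simps)
    qed
  qed
  moreover have "centred 0 (Suc m) k = 0" if m: "\<nexists>j. Suc m = k + 2 * j" for k
  proof (cases k)
    case 0
    have "\<nexists>j. m = 1 + 2 * j"
    proof
      assume "\<exists>j. m = 1 + 2 * j"
      then obtain j where "m = 1 + 2 * j" by blast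
      then have "Suc m = k + 2 * Suc j" using 0 by simp
      with m show False by blast
    qed
    then show ?thesis using 0 IH2 by (simp add: centred_Suc_0)
  next
    case (Suc k')
    have "\<nexists>j. m = k' + 2 * j" using m Suc by auto
    moreover have "\<nexists>j. m = k' + 2 + 2 * j"
    proof
      assume "\<exists>j. m = k' + 2 + 2 * j"
      then obtain j where "m = k' + 2 + 2 * j" by blast
      then have "Suc m = k + 2 * Suc j" using Suc by simp
      with m show False by blast
    qed
    ultimately show ?thesis using Suc IH2 by (simp add: centred_Suc_Suc)
  qed
  ultimately show ?case by blast
qed

lemma centred_zero_catalan:
  "centred 0 n 0 = (if even n then (-1) ^ (n div 2) * int (catalan (n div 2)) else 0)"
proof (cases "even n")
  case True
  then obtain i where "n = 2 * i" by blast
  then have "centred 0 n 0 = (-1) ^ i * ballot n i" using centred_zero[of n] by (metis add_0)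
  then show ?thesis using \<open>n = 2 * i\<close> by (simp add: catalan_eq_ballot)
next
  case False
  then have "\<nexists>j. n = 0 + 2 * j" by auto
  then show ?thesis using centred_zero[of n] False by auto
qed

text \<open>The right-hand side obeys the recursion for \<open>x = 1\<close>: at
  \<open>k = 0\<close> the contribution \<open>centred 0 m 0\<close> of the centred tunnel cancels,
  leaving \<open>- centred 0 m 1\<close>, which is the recursion for \<open>x = 0\<close>. For
  \<open>k = 0\<close> the identity lowers \<open>n\<close> by one, which exchanges the
  parities.\<close>

lemma centred_one:
  "centred 1 (Suc m) k = centred 0 m k + (if k = 0 then 0 else centred 0 m (k - 1))"
proof (induction m arbitrary: k)
  case 0
  show ?case by (cases k) (simp_all add: centred_Suc_0 centred_Suc_Suc centred_0)
next
  case (Suc m)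
  show ?case
  proof (cases k)
    case 0
    then show ?thesis
      by (simp add: centred_Suc_0[of 1 "Suc m"] centred_Suc_0[of 0] Suc.IH)
  next
    case (Suc k')
    show ?thesis
    proof (cases k')
      case 0
      then show ?thesis using \<open>k = Suc k'\<close>
        by (simp add: centred_Suc_Suc[of 1 "Suc m"] centred_Suc_Suc[of 0 m] centred_Suc_0[of 0] Suc.IH)
    next
      case (Suc k'')
      then show ?thesis using \<open>k = Suc k'\<close>
        by (simp add: centred_Suc_Suc[of 1 "Suc m"] centred_Suc_Suc[of 0 m] Suc.IH)
    qed
  qed
qed

lemma centred_one_catalan:
  assumes "n \<ge> 1"
  shows "centred 1 n 0 =
    (if even n then 0 else (-1) ^ ((n-1) div 2) * int (catalan ((n-1) div 2)))"
  using assms by (cases n) (simp_all add: centred_one centred_zero_catalan)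

subsection \<open>Decomposition of 132-avoiders at the maximum\<close>

definition avoids132_on :: "nat set \<Rightarrow> (nat \<Rightarrow> nat) \<Rightarrow> bool" where
  "avoids132_on I f \<longleftrightarrow>
     (\<forall>i\<in>I. \<forall>j\<in>I. \<forall>k\<in>I. i < j \<longrightarrow> j < k \<longrightarrow> f i < f k \<longrightarrow> \<not> f k < f j)"

lemma avoids132_onD:
  "avoids132_on I f \<Longrightarrow> i \<in> I \<Longrightarrow> j \<in> I \<Longrightarrow> k \<in> I \<Longrightarrow> i < j \<Longrightarrow> j < k \<Longrightarrow> f i < f k
    \<Longrightarrow> f k < f j \<Longrightarrow> False"
  unfolding avoids132_on_def by blast

text \<open>Separate offsets for positions and values keep the pieces of a permutation in place,
  since the weight compares absolute positions with absolute values. Extensionality makes cutting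
  and gluing mutually inverse.\<close>

definition block :: "nat \<Rightarrow> nat \<Rightarrow> nat \<Rightarrow> (nat \<Rightarrow> nat) set" where
  "block s v m = {f \<in> extensional {s<..s+m}.
     bij_betw f {s<..s+m} {v<..v+m} \<and> avoids132_on {s<..s+m} f}"

definition block_sum :: "int \<Rightarrow> nat \<Rightarrow> nat \<Rightarrow> nat \<Rightarrow> int" where
  "block_sum x s v m =
     (\<Sum>f\<in>block s v m. \<Prod>i\<in>{s<..s+m}. sign_weight x (int i - int (f i)))"

lemma finite_block [simp]: "finite (block s v m)"
proof (rule finite_subset)
  show "block s v m \<subseteq> {s<..s+m} \<rightarrow>\<^sub>E {v<..v+m}"
    by (auto simp: block_def PiE_def bij_betw_def)
qed (simp add: finite_PiE)

lemma block_range: "f \<in> block s v m \<Longrightarrow> i \<in> {s<..s+m} \<Longrightarrow> v < f i \<and> f i \<le> v + m"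
  by (auto simp: block_def bij_betw_def)

section \<open>Cutting and gluing at the maximum\<close>

text \<open>The last branch also serves arguments outside the whole interval, where an extensional
  \<open>g\<close> supplies \<open>undefined\<close>.\<close>

definition glue ::
  "nat \<Rightarrow> nat \<Rightarrow> nat \<Rightarrow> (nat \<Rightarrow> nat) \<Rightarrow> (nat \<Rightarrow> nat) \<Rightarrow> nat \<Rightarrow> nat" where
  "glue s k t f g i = (if s < i \<and> i \<le> s + k then f i else if i = Suc (s + k) then t else g i)"

text \<open>\<open>Y\<close> is closed downwards within the interval, hence an initial segment, and
  its cardinality fixes where it ends.\<close>

lemma interval_cut:
  fixes X Y :: "nat set"
  assumes XY: "X \<union> Y = {v<..v+l}" and less: "\<And>x y. x \<in> X \<Longrightarrow> y \<in> Y \<Longrightarrow> y < x"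
  shows "Y = {v<..v + card Y}" and "X = {v + card Y<..v+l}"
proof -
  have fin: "finite Y" using XY by (metis finite_Un finite_greaterThanAtMost)
  have "y \<le> v + card Y" if "y \<in> Y" for y
  proof -
    have "{v<..y} \<subseteq> Y"
    proof
      fix z assume z: "z \<in> {v<..y}"
      have "y \<le> v + l" using XY that by auto
      then have "z \<in> X \<union> Y" using XY z by auto
      then show "z \<in> Y" using less[of z y] z that by auto
    qed
    from card_mono[OF fin this] show ?thesis by simp
  qed
  then have "Y \<subseteq> {v<..v + card Y}" using XY by auto
  then show Y: "Y = {v<..v + card Y}" by (intro card_subset_eq) auto
  have "X \<inter> Y = {}" using less by blast
  then have "X = {v<..v+l} - Y" using XY by blast
  also have "\<dots> = {v + card Y<..v+l}" by (subst Y) auto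
  finally show "X = {v + card Y<..v+l}" .
qed

context
  fixes s v l k :: nat
  assumes k: "k \<le> l"
begin

lemma interval_split:
  "{s<..s + Suc l} = {s<..s+k} \<union> ({Suc (s+k)} \<union> {Suc (s+k)<..Suc (s+k) + (l-k)})"
  using k by auto

text \<open>No 132 pattern crosses the pieces: the maximum can only play the 3, and then the 1 lies
  on the left and the 2 on the right, although all left values exceed all right values.\<close>

lemma glue_in_block:
  assumes f: "f \<in> block s (v + (l-k)) k" and g: "g \<in> block (Suc (s+k)) v (l-k)"
  shows "glue s k (v + Suc l) f g \<in> block s v (Suc l)"
proof -
  let ?h = "glue s k (v + Suc l) f g"
  let ?L = "{s<..s+k}" and ?p = "Suc (s+k)" and ?R = "{Suc (s+k)<..Suc (s+k) + (l-k)}"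
  have hL: "?h i = f i" if "i \<in> ?L" for i using that by (simp add: glue_def)
  have hp: "?h ?p = v + Suc l" by (simp add: glue_def)
  have hR: "?h i = g i" if "i \<in> ?R" for i using that by (simp add: glue_def)
  have "bij_betw ?h ?L {v + (l-k)<..v+l}"
    using f k bij_betw_cong[of ?L ?h f] hL by (simp add: block_def)
  moreover have "bij_betw ?h {?p} {v + Suc l}" using hp by (simp add: bij_betw_def)
  moreover have "bij_betw ?h ?R {v<..v+(l-k)}"
    using g bij_betw_cong[of ?R ?h g] hR by (simp add: block_def)
  ultimately have "bij_betw ?h (?L \<union> ({?p} \<union> ?R))
      ({v + (l-k)<..v+l} \<union> ({v + Suc l} \<union> {v<..v+(l-k)}))"
    by (intro bij_betw_combine) auto
  moreover have "{v + (l-k)<..v+l} \<union> ({v + Suc l} \<union> {v<..v+(l-k)}) = {v<..v + Suc l}"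
    by auto
  ultimately have bij: "bij_betw ?h {s<..s + Suc l} {v<..v + Suc l}"
    by (simp only: interval_split)
  have fv: "v + (l-k) < ?h i \<and> ?h i \<le> v + l" if "i \<in> ?L" for i
    using block_range[OF f that] k hL[OF that] by simp
  have gv: "?h i \<le> v + (l-k)" if "i \<in> ?R" for i
    using block_range[OF g that] hR[OF that] by simp
  have "avoids132_on {s<..s + Suc l} ?h"
    unfolding avoids132_on_def
  proof (intro ballI impI notI)
    fix a b c
    assume abc: "a \<in> {s<..s + Suc l}" "b \<in> {s<..s + Suc l}" "c \<in> {s<..s + Suc l}"
      "a < b" "b < c" "?h a < ?h c" "?h c < ?h b"
    have top: "?h b \<le> v + Suc l" using bij abc(2) by (auto simp: bij_betw_def)
    from abc(1) consider "a \<in> ?L" | "a = ?p" | "a \<in> ?R" unfolding interval_split by blast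
    then show False
    proof cases
      case 1
      from abc(3) consider "c \<in> ?L" | "c = ?p" | "c \<in> ?R" unfolding interval_split by blast
      then show False
      proof cases
        case c: 1
        then have b: "b \<in> ?L" using abc by auto
        have "avoids132_on ?L f" using f by (simp add: block_def)
        from avoids132_onD[OF this 1 b c] show False
          using abc hL[OF 1] hL[OF b] hL[OF c] by simp
      next
        case 2
        then show False using abc top hp by simp
      next
        case 3
        then show False using abc fv[OF 1] gv[OF 3] by simp
      qed
    next
      case 2
      then show False using abc top hp by simp
    next
      case 3
      then have b: "b \<in> ?R" and c: "c \<in> ?R" using abc k by auto
      have "avoids132_on ?R g" using g by (simp add: block_def)
      from avoids132_onD[OF this 3 b c] show False
        using abc hR[OF 3] hR[OF b] hR[OF c] by simp
    qed
  qed
  moreover have "?h \<in> extensional {s<..s + Suc l}"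
    using g k by (auto simp: extensional_def glue_def block_def)
  ultimately show ?thesis using bij by (simp add: block_def)
qed

text \<open>An entry left of the maximum that is smaller than one right of it would form 132 with
  the maximum as 3. So the left values lie above the right ones, and \<open>interval_cut\<close>
  identifies both ranges.\<close>

lemma restrict_in_block:
  assumes h: "h \<in> block s v (Suc l)" and top: "h (Suc (s+k)) = v + Suc l"
  shows "restrict h {s<..s+k} \<in> block s (v + (l-k)) k"
    and "restrict h {Suc (s+k)<..Suc (s+k) + (l-k)} \<in> block (Suc (s+k)) v (l-k)"
proof -
  let ?I = "{s<..s + Suc l}"
  let ?L = "{s<..s+k}" and ?p = "Suc (s+k)" and ?R = "{Suc (s+k)<..Suc (s+k) + (l-k)}"
  have bij: "bij_betw h ?I {v<..v + Suc l}" and av: "avoids132_on ?I h"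
    using h by (auto simp: block_def)
  have inj: "inj_on h ?I" using bij by (simp add: bij_betw_def)
  have sub: "?L \<subseteq> ?I" "?R \<subseteq> ?I" "?p \<in> ?I" using k by auto
  have lt: "h i < v + Suc l" if "i \<in> ?I" "i \<noteq> ?p" for i
  proof -
    have "h i \<le> v + Suc l" using bij that(1) by (auto simp: bij_betw_def)
    moreover have "h i \<noteq> h ?p" using inj_onD[OF inj] that sub(3) by blast
    ultimately show ?thesis using top by simp
  qed
  have union: "h ` ?L \<union> h ` ?R = {v<..v+l}"
  proof -
    have "?L \<union> ?R = ?I - {?p}" using k by auto
    then have "h ` ?L \<union> h ` ?R = h ` ?I - h ` {?p}"
      using inj sub by (metis image_Un inj_on_image_set_diff Diff_subset empty_subsetI insert_subset)
    also have "\<dots> = {v<..v+l}" using bij top by (auto simp: bij_betw_def)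
    finally show ?thesis .
  qed
  have less: "y < x" if "x \<in> h ` ?L" "y \<in> h ` ?R" for x y
  proof -
    from that obtain i j where ij: "i \<in> ?L" "x = h i" "j \<in> ?R" "y = h j" by blast
    have "i < ?p" "?p < j" using ij by auto
    moreover have "h j < h ?p" using lt[of j] ij sub top by auto
    ultimately have "\<not> h i < h j"
      using avoids132_onD[OF av, of i ?p j] ij sub by blast
    moreover have "h i \<noteq> h j" using inj_onD[OF inj, of i j] ij sub by auto
    ultimately show ?thesis using ij by simp
  qed
  have "card (h ` ?R) = l - k"
    using card_image[OF inj_on_subset[OF inj sub(2)]] by simp
  with interval_cut[OF union less]
  have imR: "h ` ?R = {v<..v+(l-k)}" and imL: "h ` ?L = {v+(l-k)<..v+l}" by auto
  have "avoids132_on ?L h" "avoids132_on ?R h"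
    using av sub unfolding avoids132_on_def by blast+
  then have "avoids132_on ?L (restrict h ?L)" "avoids132_on ?R (restrict h ?R)"
    by (simp_all add: avoids132_on_def)
  moreover have "bij_betw h ?L {v+(l-k)<..v+(l-k)+k}" "bij_betw h ?R {v<..v+(l-k)}"
    using imL imR inj_on_subset[OF inj] sub k by (simp_all add: bij_betw_def)
  ultimately show "restrict h ?L \<in> block s (v + (l-k)) k" "restrict h ?R \<in> block ?p v (l-k)"
    by (simp_all add: block_def)
qed

lemma bij_betw_glue:
  "bij_betw (\<lambda>(f, g). glue s k (v + Suc l) f g)
     (block s (v + (l-k)) k \<times> block (Suc (s+k)) v (l-k))
     {h \<in> block s v (Suc l). h (Suc (s+k)) = v + Suc l}"
proof (rule bij_betw_byWitness[where f' = "\<lambda>h.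
    (restrict h {s<..s+k}, restrict h {Suc (s+k)<..Suc (s+k) + (l-k)})"])
  show "\<forall>fg\<in>block s (v + (l-k)) k \<times> block (Suc (s+k)) v (l-k).
    (restrict (case fg of (f, g) \<Rightarrow> glue s k (v + Suc l) f g) {s<..s+k},
     restrict (case fg of (f, g) \<Rightarrow> glue s k (v + Suc l) f g)
       {Suc (s+k)<..Suc (s+k) + (l-k)}) = fg"
    by (auto simp: block_def extensional_def glue_def restrict_def fun_eq_iff)
  show "\<forall>h\<in>{h \<in> block s v (Suc l). h (Suc (s+k)) = v + Suc l}.
    (case (restrict h {s<..s+k}, restrict h {Suc (s+k)<..Suc (s+k) + (l-k)}) of
      (f, g) \<Rightarrow> glue s k (v + Suc l) f g) = h"
    using k by (auto simp: block_def extensional_def glue_def restrict_def fun_eq_iff)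
  show "(\<lambda>(f, g). glue s k (v + Suc l) f g) `
      (block s (v + (l-k)) k \<times> block (Suc (s+k)) v (l-k))
    \<subseteq> {h \<in> block s v (Suc l). h (Suc (s+k)) = v + Suc l}"
    using glue_in_block by (auto simp: glue_def)
  show "(\<lambda>h. (restrict h {s<..s+k}, restrict h {Suc (s+k)<..Suc (s+k) + (l-k)})) `
      {h \<in> block s v (Suc l). h (Suc (s+k)) = v + Suc l}
    \<subseteq> block s (v + (l-k)) k \<times> block (Suc (s+k)) v (l-k)"
    using restrict_in_block by auto
qed

lemma block_sum_max_at:
  "(\<Sum>h\<in>{h \<in> block s v (Suc l). h (Suc (s+k)) = v + Suc l}.
      \<Prod>i\<in>{s<..s + Suc l}. sign_weight x (int i - int (h i)))
   = sign_weight x (int s + int k - int v - int l) *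
     (block_sum x s (v + (l-k)) k * block_sum x (Suc (s+k)) v (l-k))"
proof -
  let ?L = "{s<..s+k}" and ?p = "Suc (s+k)" and ?R = "{Suc (s+k)<..Suc (s+k) + (l-k)}"
  let ?w = "\<lambda>h i. sign_weight x (int i - int (h i))"
  have prod: "prod (?w (glue s k (v + Suc l) f g)) {s<..s + Suc l}
      = sign_weight x (int s + int k - int v - int l) * (prod (?w f) ?L * prod (?w g) ?R)" for f g
  proof -
    let ?h = "glue s k (v + Suc l) f g"
    have "prod (?w ?h) {s<..s + Suc l} = prod (?w ?h) ?L * (?w ?h ?p * prod (?w ?h) ?R)"
      unfolding interval_split
      by (subst prod.union_disjoint, simp, simp, force)+ simp
    also have "prod (?w ?h) ?L = prod (?w f) ?L"
      by (intro prod.cong) (auto simp: glue_def)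
    also have "prod (?w ?h) ?R = prod (?w g) ?R"
      by (intro prod.cong) (auto simp: glue_def)
    also have "?w ?h ?p = sign_weight x (int s + int k - int v - int l)"
      by (simp add: glue_def algebra_simps)
    finally show ?thesis by (simp add: mult_ac)
  qed
  show ?thesis
    unfolding sum.reindex_bij_betw[OF bij_betw_glue, symmetric] block_sum_def
    by (simp only: prod case_prod_unfold sum_distrib_left[symmetric])
       (simp add: sum_product sum.cartesian_product case_prod_unfold)
qed

end

section \<open>From avoiders to signed Dyck paths\<close>

lemma block_sum_Suc:
  "block_sum x s v (Suc l) = (\<Sum>k\<le>l. sign_weight x (int s + int k - int v - int l) *
     (block_sum x s (v + (l-k)) k * block_sum x (Suc (s+k)) v (l-k)))"
proof -
  let ?B = "\<lambda>k. {h \<in> block s v (Suc l). h (Suc (s+k)) = v + Suc l}"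
  have bij: "bij_betw h {s<..s + Suc l} {v<..v + Suc l}" if "h \<in> block s v (Suc l)" for h
    using that by (simp add: block_def)
  have union: "block s v (Suc l) = (\<Union>k\<le>l. ?B k)"
  proof -
    have "\<exists>k\<le>l. h (Suc (s+k)) = v + Suc l" if "h \<in> block s v (Suc l)" for h
    proof -
      have "v + Suc l \<in> h ` {s<..s + Suc l}" using bij[OF that] by (auto simp: bij_betw_def)
      then obtain i where i: "s < i" "i \<le> s + Suc l" "h i = v + Suc l" by auto
      then have "h (Suc (s + (i - Suc s))) = v + Suc l" "i - Suc s \<le> l" by auto
      then show ?thesis by blast
    qed
    then show ?thesis by blast
  qed
  have disjoint: "?B a \<inter> ?B b = {}" if "a \<le> l" "b \<le> l" "a \<noteq> b" for a b
  proof (rule ccontr)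
    assume "?B a \<inter> ?B b \<noteq> {}"
    then obtain h where "h \<in> ?B a" "h \<in> ?B b" by blast
    then have h: "h \<in> block s v (Suc l)" "h (Suc (s+a)) = h (Suc (s+b))" by simp_all
    from bij[OF h(1)] have "inj_on h {s<..s + Suc l}" by (simp add: bij_betw_def)
    from inj_onD[OF this h(2)] that show False by auto
  qed
  have "block_sum x s v (Suc l) = (\<Sum>k\<le>l. \<Sum>h\<in>?B k.
      \<Prod>i\<in>{s<..s + Suc l}. sign_weight x (int i - int (h i)))"
    unfolding block_sum_def
    by (subst union, rule sum.UNION_disjoint) (use disjoint in auto)
  also have "\<dots> = (\<Sum>k\<le>l. sign_weight x (int s + int k - int v - int l) *
     (block_sum x s (v + (l-k)) k * block_sum x (Suc (s+k)) v (l-k)))"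
    by (intro sum.cong refl block_sum_max_at) simp
  finally show ?thesis .
qed

lemma block_sum_0 [simp]: "block_sum x s v 0 = 1"
proof -
  have "block s v 0 = {\<lambda>_. undefined}"
    by (auto simp: block_def avoids132_on_def bij_betw_def)
  then show ?thesis by (simp add: block_sum_def)
qed

lemma sign_weight_double: "sign_weight x (2 * e) = sign_weight x e"
  by (simp add: sign_weight_def)

text \<open>An entry at position \<open>i\<close> with value \<open>f i\<close> corresponds to a tunnel whose endpoints add up
  to \<open>2 * (i - f i)\<close>; the maximal entry belongs to the first arch.\<close>

lemma block_sum_eq_arch:
  "block_sum x s v m = arch x (int s - int v - int m) (int s - int v + int m)"
proof (induction m arbitrary: s v rule: less_induct)
  case (less m)
  show ?case
  proof (cases m)
    case 0
    then show ?thesis by simp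
  next
    case (Suc l)
    let ?s = "int s - int v - int m" and ?t = "int s - int v + int m"
    let ?c = "\<lambda>k. ?s + 2 * int k + 1"
    let ?g = "\<lambda>c. sign_weight x (?s + c + 1) * (arch x (?s+1) c * arch x (c+1) ?t)"
    have "arch x ?s ?t = sum ?g {?s+1..<?t}" using Suc by (intro arch_left) simp
    \<comment> \<open>By parity only even lengths \<open>2k\<close> survive under the first arch;
      \<open>k\<close> is the number of entries left of the maximum.\<close>
    also have "\<dots> = sum ?g (?c ` {..l})"
    proof (rule sum.mono_neutral_right)
      show "?c ` {..l} \<subseteq> {?s+1..<?t}" using Suc by auto
      show "\<forall>c\<in>{?s+1..<?t} - ?c ` {..l}. ?g c = 0"
      proof
        fix c assume c: "c \<in> {?s+1..<?t} - ?c ` {..l}"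
        have "odd (c - (?s + 1))"
        proof
          assume "even (c - (?s + 1))"
          then obtain j where j: "c - (?s + 1) = 2 * j" by blast
          then have "c = ?c (nat j)" "nat j \<le> l" using c Suc by auto
          then show False using c by blast
        qed
        then show "?g c = 0" by (simp add: arch_odd)
      qed
    qed simp
    also have "\<dots> = (\<Sum>k\<le>l. ?g (?c k))" by (subst sum.reindex) (auto simp: inj_on_def)
    also have "\<dots> = block_sum x s v m"
      unfolding Suc block_sum_Suc
    proof (intro sum.cong refl)
      fix k assume "k \<in> {..l}"
      then have k: "k \<le> l" by simp
      let ?u = "int s - int v - int (Suc l)"
      have "?u + (?u + 2 * int k + 1) + 1 = 2 * (int s + int k - int v - int l)" by simp
      moreover have "block_sum x s (v + (l-k)) k = arch x (?u + 1) (?u + 2 * int k + 1)"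
        using k Suc by (subst less.IH) (simp_all add: of_nat_diff algebra_simps)
      moreover have "block_sum x (Suc (s+k)) v (l-k)
          = arch x (?u + 2 * int k + 1 + 1) (int s - int v + int (Suc l))"
        using k Suc by (subst less.IH) (simp_all add: of_nat_diff algebra_simps)
      ultimately show "sign_weight x (?u + (?u + 2 * int k + 1) + 1) *
          (arch x (?u + 1) (?u + 2 * int k + 1) *
           arch x (?u + 2 * int k + 1 + 1) (int s - int v + int (Suc l))) =
        sign_weight x (int s + int k - int v - int l) *
          (block_sum x s (v + (l-k)) k * block_sum x (Suc (s+k)) v (l-k))"
        by (simp only: sign_weight_double)
    qed
    finally show ?thesis by simp
  qed
qed

subsection \<open>Avoiders and the reverse-complement-inverse symmetry\<close>

context
  notes One_nat_def [simp del]
begin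

section \<open>Patterns of length three and weights of permutations\<close>

lemma contains_pattern_3:
  "contains_pattern p n tau 3 \<longleftrightarrow>
    (\<exists>i j k. 1 \<le> i \<and> i < j \<and> j < k \<and> k \<le> n \<and>
      (p i < p j \<longleftrightarrow> tau 1 < tau 2) \<and> (p j < p i \<longleftrightarrow> tau 2 < tau 1) \<and>
      (p i < p k \<longleftrightarrow> tau 1 < tau 3) \<and> (p k < p i \<longleftrightarrow> tau 3 < tau 1) \<and>
      (p j < p k \<longleftrightarrow> tau 2 < tau 3) \<and> (p k < p j \<longleftrightarrow> tau 3 < tau 2))"
  (is "_ \<longleftrightarrow> (\<exists>i j k. ?P i j k)")
proof
  have three: "{1..3::nat} = {1, 2, 3}" by auto
  {
    assume "contains_pattern p n tau 3"
    then obtain idx :: "nat \<Rightarrow> nat" where idx: "strict_mono_on {1..3} idx" "idx ` {1..3} \<subseteq> {1..n}"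
      "\<forall>a\<in>{1..3}. \<forall>b\<in>{1..3}. p (idx a) < p (idx b) \<longleftrightarrow> tau a < tau b"
      unfolding contains_pattern_def by blast
    have "idx 1 < idx 2" "idx 2 < idx 3" using strict_mono_onD[OF idx(1)] by auto
    then have "?P (idx 1) (idx 2) (idx 3)" using idx(2,3) unfolding three by auto
    then show "\<exists>i j k. ?P i j k" by blast
  next
    assume "\<exists>i j k. ?P i j k"
    then obtain i j k where P: "?P i j k" by blast
    let ?idx = "\<lambda>a::nat. if a = 1 then i else if a = 2 then j else k"
    have "strict_mono_on {1..3} ?idx"
      using P unfolding three strict_mono_on_def by auto
    moreover have "?idx ` {1..3} \<subseteq> {1..n}" using P unfolding three by auto
    moreover have "\<forall>a\<in>{1..3}. \<forall>b\<in>{1..3}. p (?idx a) < p (?idx b) \<longleftrightarrow> tau a < tau b"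
      using P unfolding three by auto
    ultimately show "contains_pattern p n tau 3" unfolding contains_pattern_def by blast
  }
qed

lemma contains_pattern_132:
  "contains_pattern p n pat132 3 \<longleftrightarrow>
    (\<exists>i j k. 1 \<le> i \<and> i < j \<and> j < k \<and> k \<le> n \<and> p i < p k \<and> p k < p j)"
  unfolding contains_pattern_3 by (intro ex_cong1) (auto simp: pat132_def)

lemma contains_pattern_213:
  "contains_pattern p n pat213 3 \<longleftrightarrow>
    (\<exists>i j k. 1 \<le> i \<and> i < j \<and> j < k \<and> k \<le> n \<and> p j < p i \<and> p i < p k)"
  unfolding contains_pattern_3 by (intro ex_cong1) (auto simp: pat213_def)

lemma avoids132_on_iff: "avoids132_on {1..n} p \<longleftrightarrow> \<not> contains_pattern p n pat132 3"
proof
  assume av: "avoids132_on {1..n} p"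
  show "\<not> contains_pattern p n pat132 3"
    unfolding contains_pattern_132 using avoids132_onD[OF av] by fastforce
next
  assume "\<not> contains_pattern p n pat132 3"
  then show "avoids132_on {1..n} p"
    unfolding contains_pattern_132 avoids132_on_def by (metis atLeastAtMost_iff)
qed

lemma finite_avoiders [simp]: "finite (avoiders n tau k)"
  by (rule finite_subset[OF _ finite_permutations[of "{1..n}"]]) (auto simp: avoiders_def)

text \<open>The case of zero offsets. Permutations are the identity outside \<open>{1..n}\<close>
  while members of \<open>block\<close> are \<open>undefined\<close> there; restriction and
  extension by the identity translate between them.\<close>

lemma avoiders_sum_eq_arch:
  "(\<Sum>p\<in>avoiders n pat132 3. \<Prod>i\<in>{1..n}. sign_weight x (int i - int (p i)))
    = arch x (- int n) (int n)"
proof -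
  have I: "{0<..0+n} = {1..n}" by auto
  have "(\<Sum>p\<in>avoiders n pat132 3. \<Prod>i\<in>{1..n}. sign_weight x (int i - int (p i)))
      = (\<Sum>f\<in>block 0 0 n. \<Prod>i\<in>{1..n}. sign_weight x (int i - int (f i)))"
  proof (rule sum.reindex_bij_witness[where
        i = "\<lambda>f i. if i \<in> {1..n} then f i else i" and j = "\<lambda>p. restrict p {1..n}"])
    fix p assume "p \<in> avoiders n pat132 3"
    then have p: "p permutes {1..n}" "avoids132_on {1..n} p"
      by (auto simp: avoiders_def avoids132_on_iff)
    show "(\<lambda>i. if i \<in> {1..n} then restrict p {1..n} i else i) = p"
      using permutes_not_in[OF p(1)] by (auto simp: fun_eq_iff)
    show "restrict p {1..n} \<in> block 0 0 n"
      using permutes_imp_bij[OF p(1)] p(2)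
      unfolding block_def I by (simp add: avoids132_on_def)
  next
    fix f assume f: "f \<in> block 0 0 n"
    let ?p = "\<lambda>i. if i \<in> {1..n} then f i else i"
    show "restrict ?p {1..n} = f"
      using f unfolding block_def I by (auto simp: extensional_def fun_eq_iff)
    have "bij_betw ?p {1..n} {1..n} \<longleftrightarrow> bij_betw f {1..n} {1..n}"
      by (rule bij_betw_cong) simp
    then have "?p permutes {1..n}"
      using f unfolding block_def I by (intro bij_imp_permutes) auto
    moreover have "avoids132_on {1..n} ?p"
      using f unfolding block_def I by (simp add: avoids132_on_def)
    ultimately show "?p \<in> avoiders n pat132 3"
      by (simp add: avoiders_def avoids132_on_iff)
  qed (auto intro!: prod.cong)
  also have "\<dots> = block_sum x 0 0 n" unfolding block_sum_def I ..
  finally show ?thesis by (simp add: block_sum_eq_arch)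
qed

lemma prod_sign_weight_one:
  "(\<Prod>i\<in>{1..n}. sign_weight 1 (int i - int (p i))) = (-1) ^ exc n p"
proof -
  have "(\<Prod>i\<in>{1..n}. sign_weight 1 (int i - int (p i))) = (\<Prod>i\<in>{1..n}. if p i > i then -1 else 1)"
    by (intro prod.cong) (auto simp: sign_weight_def)
  also have "\<dots> = (\<Prod>i\<in>{i\<in>{1..n}. p i > i}. -1)"
    by (rule prod.inter_filter[symmetric]) simp
  finally show ?thesis by (simp add: exc_def)
qed

text \<open>One fixed point makes the product vanish; without any, the weights for
  \<open>x = 0\<close> and \<open>x = 1\<close> agree.\<close>

lemma prod_sign_weight_zero:
  "(\<Prod>i\<in>{1..n}. sign_weight 0 (int i - int (p i)))
    = (if \<forall>i\<in>{1..n}. p i \<noteq> i then (-1) ^ exc n p else 0)"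
proof (cases "\<forall>i\<in>{1..n}. p i \<noteq> i")
  case True
  have "(\<Prod>i\<in>{1..n}. sign_weight 0 (int i - int (p i)))
      = (\<Prod>i\<in>{1..n}. sign_weight 1 (int i - int (p i)))"
  proof (intro prod.cong refl)
    fix i assume "i \<in> {1..n}"
    then have "p i \<noteq> i" using True by blast
    then show "sign_weight 0 (int i - int (p i)) = sign_weight 1 (int i - int (p i))"
      by (simp add: sign_weight_def)
  qed
  then show ?thesis using True prod_sign_weight_one by simp
next
  case False
  then obtain i where "i \<in> {1..n}" "p i = i" by blast
  then have "sign_weight 0 (int i - int (p i)) = 0" by (simp add: sign_weight_def)
  then have "(\<Prod>i\<in>{1..n}. sign_weight 0 (int i - int (p i))) = 0"
    using \<open>i \<in> {1..n}\<close> by (intro prod_zero) auto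
  then show ?thesis using False by auto
qed

text \<open>Reverse-complement of the inverse.\<close>

definition rci :: "nat \<Rightarrow> (nat \<Rightarrow> nat) \<Rightarrow> nat \<Rightarrow> nat" where
  "rci n p i = (if i \<in> {1..n} then n + 1 - inv p (n + 1 - i) else i)"

context
  fixes n :: nat and p :: "nat \<Rightarrow> nat"
  assumes p: "p permutes {1..n}"
begin

text \<open>The graph is reflected in the antidiagonal: the point \<open>(i, p i)\<close> moves to
  \<open>(n+1 - p i, n+1 - i)\<close>.\<close>

lemma rci_apply:
  assumes "i \<in> {1..n}"
  shows "rci n p (n + 1 - p i) = n + 1 - i"
proof -
  have "p i \<in> {1..n}" using permutes_in_image[OF p] assms by simp
  then show ?thesis using permutes_inverses(2)[OF p] by (auto simp: rci_def)
qed

lemma rci_permutes: "rci n p permutes {1..n}"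
proof (rule bij_imp_permutes)
  let ?r = "\<lambda>i. n + 1 - i"
  have r: "bij_betw ?r {1..n} {1..n}"
    by (rule bij_betw_byWitness[where f' = ?r]) auto
  have "bij_betw (?r \<circ> inv p \<circ> ?r) {1..n} {1..n}"
    using r permutes_imp_bij[OF permutes_inv[OF p]] by (intro bij_betw_trans)
  then show "bij_betw (rci n p) {1..n} {1..n}"
    by (rule bij_betw_cong[THEN iffD1, rotated]) (simp add: rci_def)
qed (auto simp: rci_def)

lemma rci_involution: "rci n (rci n p) = p"
proof
  fix i
  show "rci n (rci n p) i = p i"
  proof (cases "i \<in> {1..n}")
    case True
    then have pi: "p i \<in> {1..n}" using permutes_in_image[OF p] by simp
    have "inv (rci n p) (n + 1 - i) = n + 1 - p i"
      using rci_apply[OF True] permutes_inverses(2)[OF rci_permutes] by metis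
    then show ?thesis using True pi by (auto simp: rci_def)
  next
    case False
    then show ?thesis using permutes_not_in[OF p] by (simp only: rci_def) auto
  qed
qed

text \<open>The reflection keeps each point on its side of the main diagonal, so \<open>i\<close> to
  \<open>n+1 - p i\<close> matches excedances with excedances.\<close>

lemma exc_rci: "exc n (rci n p) = exc n p"
proof -
  have "bij_betw (\<lambda>i. n + 1 - p i) {i\<in>{1..n}. p i > i} {i\<in>{1..n}. rci n p i > i}"
  proof (rule bij_betw_byWitness[where f' = "\<lambda>i. n + 1 - rci n p i"])
    have range: "p i \<in> {1..n}" "rci n p i \<in> {1..n}" if "i \<in> {1..n}" for i
      using permutes_in_image[OF p] permutes_in_image[OF rci_permutes] that by auto
    have pullback: "p (n + 1 - rci n p i) = n + 1 - i" if "i \<in> {1..n}" for i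
      using that range(2)[OF that] permutes_inverses(1)[OF p] permutes_in_image[OF permutes_inv[OF p]]
      by (auto simp: rci_def)
    show "\<forall>i\<in>{i\<in>{1..n}. p i > i}. n + 1 - rci n p (n + 1 - p i) = i"
      using rci_apply by auto
    show "\<forall>i\<in>{i\<in>{1..n}. rci n p i > i}. n + 1 - p (n + 1 - rci n p i) = i"
      using pullback by auto
    show "(\<lambda>i. n + 1 - p i) ` {i\<in>{1..n}. p i > i} \<subseteq> {i\<in>{1..n}. rci n p i > i}"
    proof
      fix y assume "y \<in> (\<lambda>i. n + 1 - p i) ` {i\<in>{1..n}. p i > i}"
      then obtain i where "y = n + 1 - p i" "i \<in> {1..n}" "p i > i" by blast
      then show "y \<in> {i\<in>{1..n}. rci n p i > i}"
        using rci_apply[of i] range(1)[of i] by auto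
    qed
    show "(\<lambda>i. n + 1 - rci n p i) ` {i\<in>{1..n}. rci n p i > i} \<subseteq> {i\<in>{1..n}. p i > i}"
    proof
      fix y assume "y \<in> (\<lambda>i. n + 1 - rci n p i) ` {i\<in>{1..n}. rci n p i > i}"
      then obtain i where "y = n + 1 - rci n p i" "i \<in> {1..n}" "rci n p i > i" by blast
      then show "y \<in> {i\<in>{1..n}. p i > i}"
        using pullback[of i] range(2)[of i] by auto
    qed
  qed
  from bij_betw_same_card[OF this] show ?thesis by (simp add: exc_def)
qed

lemma rci_derangement:
  assumes "\<forall>i\<in>{1..n}. p i \<noteq> i"
  shows "\<forall>i\<in>{1..n}. rci n p i \<noteq> i"
proof (intro ballI notI)
  fix i assume i: "i \<in> {1..n}" "rci n p i = i"
  let ?j = "inv p (n + 1 - i)"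
  have j: "?j \<in> {1..n}" using permutes_in_image[OF permutes_inv[OF p], of "n+1-i"] i by auto
  then have "?j = n + 1 - i" using i by (auto simp: rci_def)
  then have "p ?j = ?j" using permutes_inverses(1)[OF p] by metis
  then show False using assms j by blast
qed

text \<open>Reflected, the entries at \<open>j\<close>, \<open>k\<close>, \<open>i\<close> appear in
  this order from left to right, with values \<open>n+1-j\<close>, \<open>n+1-k\<close>,
  \<open>n+1-i\<close>: middle, smallest, largest.\<close>

lemma rci_contains_213:
  assumes "contains_pattern p n pat132 3"
  shows "contains_pattern (rci n p) n pat213 3"
proof -
  from assms obtain i j k where ijk: "1 \<le> i" "i < j" "j < k" "k \<le> n" "p i < p k" "p k < p j"
    unfolding contains_pattern_132 by blast
  then have mem: "i \<in> {1..n}" "j \<in> {1..n}" "k \<in> {1..n}" by auto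
  then have "p i \<in> {1..n}" "p j \<in> {1..n}" by (simp_all only: permutes_in_image[OF p])
  then have "1 \<le> n + 1 - p j \<and> n + 1 - p j < n + 1 - p k \<and> n + 1 - p k < n + 1 - p i \<and>
     n + 1 - p i \<le> n \<and> rci n p (n + 1 - p k) < rci n p (n + 1 - p j) \<and>
     rci n p (n + 1 - p j) < rci n p (n + 1 - p i)"
    unfolding mem[THEN rci_apply] using ijk by auto
  then show ?thesis unfolding contains_pattern_213 by blast
qed

lemma rci_contains_132:
  assumes "contains_pattern p n pat213 3"
  shows "contains_pattern (rci n p) n pat132 3"
proof -
  from assms obtain i j k where ijk: "1 \<le> i" "i < j" "j < k" "k \<le> n" "p j < p i" "p i < p k"
    unfolding contains_pattern_213 by blast
  then have mem: "i \<in> {1..n}" "j \<in> {1..n}" "k \<in> {1..n}" by auto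
  then have "p k \<in> {1..n}" "p j \<in> {1..n}" by (simp_all only: permutes_in_image[OF p])
  then have "1 \<le> n + 1 - p k \<and> n + 1 - p k < n + 1 - p i \<and> n + 1 - p i < n + 1 - p j \<and>
     n + 1 - p j \<le> n \<and> rci n p (n + 1 - p k) < rci n p (n + 1 - p j) \<and>
     rci n p (n + 1 - p j) < rci n p (n + 1 - p i)"
    unfolding mem[THEN rci_apply] using ijk by auto
  then show ?thesis unfolding contains_pattern_132 by blast
qed

end

text \<open>A 132 in \<open>rci n p\<close> would reflect back to a 213 in \<open>p\<close>, because
  \<open>rci\<close> is an involution.\<close>

lemma rci_avoiders_213: "p \<in> avoiders n pat213 3 \<Longrightarrow> rci n p \<in> avoiders n pat132 3"
  using rci_contains_213[OF rci_permutes, of p n]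
  by (auto simp: avoiders_def rci_permutes rci_involution)

lemma rci_avoiders_132: "p \<in> avoiders n pat132 3 \<Longrightarrow> rci n p \<in> avoiders n pat213 3"
  using rci_contains_132[OF rci_permutes, of p n]
  by (auto simp: avoiders_def rci_permutes rci_involution)

lemma avoiders_permutes: "p \<in> avoiders n tau k \<Longrightarrow> p permutes {1..n}"
  by (simp add: avoiders_def)

lemma sum_exc_avoiders_213:
  "(\<Sum>p\<in>avoiders n pat213 3. (-1::int) ^ exc n p) = (\<Sum>p\<in>avoiders n pat132 3. (-1) ^ exc n p)"
  by (rule sum.reindex_bij_witness[where i = "rci n" and j = "rci n"])
     (simp_all add: rci_avoiders_213 rci_avoiders_132 rci_involution exc_rci avoiders_permutes)

lemma sum_exc_derangement_avoiders_213:
  "(\<Sum>p\<in>derangement_avoiders n pat213 3. (-1::int) ^ exc n p)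
    = (\<Sum>p\<in>derangement_avoiders n pat132 3. (-1) ^ exc n p)"
  unfolding derangement_avoiders_def
  by (rule sum.reindex_bij_witness[where i = "rci n" and j = "rci n"])
     (auto simp: rci_avoiders_213 rci_avoiders_132 rci_involution exc_rci avoiders_permutes
       dest: rci_derangement[OF avoiders_permutes])

lemma arch_centred: "arch x (- int n) (int n) = centred x n 0"
  by (simp add: centred_def)

end

theorem theorem5p9:
  fixes n :: nat
  assumes "n \<ge> 1"
  shows "((\<Sum>p\<in>avoiders n pat213 3. (-1::int) ^ exc n p) =
           (if even n then 0 else (-1) ^ ((n-1) div 2) * int (catalan ((n-1) div 2)))) \<and>
         ((\<Sum>p\<in>avoiders n pat132 3. (-1::int) ^ exc n p) =
           (if even n then 0 else (-1) ^ ((n-1) div 2) * int (catalan ((n-1) div 2)))) \<and>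
         ((\<Sum>p\<in>derangement_avoiders n pat213 3. (-1::int) ^ exc n p) =
           (if even n then (-1) ^ (n div 2) * int (catalan (n div 2)) else 0)) \<and>
         ((\<Sum>p\<in>derangement_avoiders n pat132 3. (-1::int) ^ exc n p) =
           (if even n then (-1) ^ (n div 2) * int (catalan (n div 2)) else 0))"
proof -
  have all: "(\<Sum>p\<in>avoiders n pat132 3. (-1::int) ^ exc n p) = centred 1 n 0"
    using avoiders_sum_eq_arch[of 1 n] by (simp only: prod_sign_weight_one arch_centred)
  \<comment> \<open>Moving the derangement condition into the summand gives the product of weights
    for \<open>x = 0\<close>.\<close>
  have "(\<Sum>p\<in>derangement_avoiders n pat132 3. (-1::int) ^ exc n p)
      = (\<Sum>p\<in>avoiders n pat132 3. if \<forall>i\<in>{1..n}. p i \<noteq> i then (-1) ^ exc n p else 0)"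
    unfolding derangement_avoiders_def by (rule sum.inter_filter) simp
  also have "\<dots> = centred 0 n 0"
    using avoiders_sum_eq_arch[of 0 n] by (simp only: prod_sign_weight_zero arch_centred)
  finally show ?thesis
    using all centred_one_catalan[OF assms] centred_zero_catalan[of n]
    by (simp only: sum_exc_avoiders_213 sum_exc_derangement_avoiders_213)
qed

end
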